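(* The following two statements are equivalent. (a) For all $R_-\subseteq U$ and $S_-\subseteq F$, $$|R_-|\le e(R_-,F\setminus S_-)+e(S_-\cap F^C,C)+|U^0|\cdot e(S_-\cap F^0,C).$$ (b) For all $j=1,\dots,l$ and all $S_-\subseteq F^j$, $$|R_-|\le|S_-|,\qquad\text{where } R_-=\{v\in U:\delta^+(v)\subseteq S_-\}.$$
   Context: Let $G=(V,E)$ be a finite simple graph with $n=|V|$, and let $\Pi_p=(C_1,\dots,C_n)$ be a partial $k$-coloring: pairwise disjoint stable subsets of $V$ with $C_i=\emptyset$ for $i>k$. Let $U=V\setminus\bigcup_i C_i$ be the set of uncolored vertices and, for $v\in U$, let $F(v)=\{1,\dots,n\}\setminus\{i: C_i\text{ contains a neighbor of }v\}$ be its free colors. Let $1\le k_0\le n$. Let $U$ be the disjoint union of $U^0,U^1,\dots,U^l$ ($l\ge1$), where $U^1,\dots,U^l$ are pairwise non-adjacent cliques of $G$ and $U^0$ consists of the remaining uncolored vertices. Define a directed graph with vertex set $U\cup F\cup C$, where $C=\{1,\dots,k_0\}$, $F=\bigcup_{j=0}^l F^j$, and each $F^j=\{f^j(1),\dots,f^j(k_0)\}$ is a separate copy of $C$; put $F^C=\bigcup_{j=1}^l F^j$. Its arcs are $A_2=\bigcup_{j=0}^l\{(v,f^j(i)): v\in U^j,\ i\in F(v),\ 1\le i\le k_0\}$ and $A_3=\bigcup_{j=0}^l\{(f^j(i),i):1\le i\le k_0\}$. For a vertex $v$, $\delta^+(v)$ is the set of heads of arcs with tail $v$; $e(W_1,W_2)$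 is the number of arcs with tail in $W_1$ and head in $W_2$. The conditions in (a) are the generalized Hall conditions with only negatively signed vertices and with the signed subset $T_-\subseteq C$ equal to $\emptyset$. *)

theory Defs
  imports "HOL-Library.Ramsey" "HOL-Library.Disjoint_Sets" "Graph_Theory.Pair_Digraph"
begin

section \<open>Partial colorings of finite simple graphs\<close>

text \<open>The predicates \<^const>\<open>clique\<close> and \<^const>\<open>indep\<close> (stable set) are those of
  \<^theory>\<open>HOL-Library.Ramsey\<close>; they need not be maximal and may be empty.\<close>

definition simple_graph :: "'a set \<Rightarrow> 'a set set \<Rightarrow> bool" where
  "simple_graph V E \<longleftrightarrow> finite V \<and> E \<subseteq> nsets V 2"

text \<open>A tuple \<open>(C\<^sub>1, \<dots>, C\<^sub>n)\<close> with \<open>n = |V|\<close> is a function on \<^typ>\<open>nat\<close>, of which only the values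
  on \<open>{1..card V}\<close> matter.\<close>

definition partial_coloring ::
  "'a set \<Rightarrow> 'a set set \<Rightarrow> nat \<Rightarrow> (nat \<Rightarrow> 'a set) \<Rightarrow> bool" where
  "partial_coloring V E k C \<longleftrightarrow>
     (\<forall>i\<in>{1..card V}. C i \<subseteq> V \<and> indep (C i) E) \<and>
     disjoint_family_on C {1..card V} \<and>
     (\<forall>i\<in>{1..card V}. i > k \<longrightarrow> C i = {})"

definition uncolored :: "'a set \<Rightarrow> (nat \<Rightarrow> 'a set) \<Rightarrow> 'a set" where
  "uncolored V C = V - (\<Union>i\<in>{1..card V}. C i)"

definition free_colors ::
  "'a set \<Rightarrow> 'a set set \<Rightarrow> (nat \<Rightarrow> 'a set) \<Rightarrow> 'a \<Rightarrow> nat set" where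
  "free_colors V E C v = {1..card V} - {i. \<exists>w\<in>C i. {v, w} \<in> E}"

text \<open>\<open>P 1, \<dots>, P l\<close> are the cliques and \<open>P 0\<close> is the set of remaining uncolored vertices.\<close>

definition clique_decomposition ::
  "'a set set \<Rightarrow> 'a set \<Rightarrow> nat \<Rightarrow> (nat \<Rightarrow> 'a set) \<Rightarrow> bool" where
  "clique_decomposition E U l P \<longleftrightarrow>
     disjoint_family_on P {0..l} \<and> (\<Union>j\<in>{0..l}. P j) = U \<and>
     (\<forall>j\<in>{1..l}. clique (P j) E) \<and>
     (\<forall>i\<in>{1..l}. \<forall>j\<in>{1..l}. i \<noteq> j \<longrightarrow> (\<forall>v\<in>P i. \<forall>w\<in>P j. {v, w} \<notin> E))"


section \<open>The directed graph\<close>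

text \<open>\<open>Copy j i\<close> is \<open>f\<^sup>j(i)\<close>.\<close>

datatype 'a node = Vertex 'a | Copy nat nat | Color nat

definition color_nodes :: "nat \<Rightarrow> 'a node set" where
  "color_nodes k0 = Color ` {1..k0}"

definition copy_nodes :: "nat \<Rightarrow> nat \<Rightarrow> 'a node set" where
  "copy_nodes k0 j = Copy j ` {1..k0}"

definition arcs2 :: "nat \<Rightarrow> nat \<Rightarrow> ('a \<Rightarrow> nat set) \<Rightarrow> (nat \<Rightarrow> 'a set) \<Rightarrow> 'a node rel" where
  "arcs2 k0 l Fr P =
     (\<Union>j\<in>{0..l}. {(Vertex v, Copy j i) | v i. v \<in> P j \<and> i \<in> Fr v \<and> 1 \<le> i \<and> i \<le> k0})"

definition arcs3 :: "nat \<Rightarrow> nat \<Rightarrow> 'a node rel" where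
  "arcs3 k0 l = (\<Union>j\<in>{0..l}. {(Copy j i, Color i) | i. 1 \<le> i \<and> i \<le> k0})"

definition coloring_digraph ::
  "nat \<Rightarrow> nat \<Rightarrow> ('a \<Rightarrow> nat set) \<Rightarrow> (nat \<Rightarrow> 'a set) \<Rightarrow> ('a node, 'a node \<times> 'a node) pre_digraph"
  where
  "coloring_digraph k0 l Fr P = with_proj
     \<lparr> pverts = Vertex ` (\<Union>j\<in>{0..l}. P j) \<union> (\<Union>j\<in>{0..l}. copy_nodes k0 j) \<union> color_nodes k0,
       parcs = arcs2 k0 l Fr P \<union> arcs3 k0 l \<rparr>"

definition out_heads :: "('v, 'b) pre_digraph \<Rightarrow> 'v \<Rightarrow> 'v set" where
  "out_heads D v = head D ` out_arcs D v"

definition num_arcs :: "('v, 'b) pre_digraph \<Rightarrow> 'v set \<Rightarrow> 'v set \<Rightarrow> nat" where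
  "num_arcs D W1 W2 = card {a \<in> arcs D. tail D a \<in> W1 \<and> head D a \<in> W2}"

end

theory Submission
  imports Defs
begin

text \<open>Each copy node has exactly one outgoing arc, so an arc count from copy nodes \<open>S\<close> into the colors
  is just \<open>|S|\<close> (\<open>num_arcs_copies\<close>). With this the passage from (a) to (b) is an instance: for
  \<open>S \<subseteq> F\<^sup>j\<close> with \<open>j \<ge> 1\<close> and \<open>R = {v. \<delta>\<^sup>+(v) \<subseteq> S}\<close> no arc leads from \<open>R\<close> to \<open>F - S\<close>, and \<open>S\<close> misses
  \<open>F\<^sup>0\<close>, so that only \<open>|S|\<close> remains on the right.

  Conversely, split \<open>R\<close> according to whether \<open>\<delta>\<^sup>+(v) \<subseteq> S\<close>. Every \<open>v\<close> that violates this inclusion is the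
  tail of an arc into \<open>F - S\<close>, so these vertices are paid for by \<open>e(R, F - S)\<close>
  (\<open>card_tails_le_num_arcs\<close>). The others split further along \<open>U\<^sup>0, \<dots>, U\<^sup>l\<close>. The out-neighbors of
  a vertex of \<open>U\<^sup>j\<close> lie in \<open>F\<^sup>j\<close>, so for \<open>j \<ge> 1\<close> condition (b) for \<open>S \<inter> F\<^sup>j\<close> bounds the part in
  \<open>U\<^sup>j\<close> by \<open>|S \<inter> F\<^sup>j|\<close>. For the part in \<open>U\<^sup>0\<close> the crude bound \<open>|U\<^sup>0|\<close> is enough once \<open>S\<close> meets \<open>F\<^sup>0\<close>;
  and \<open>S\<close> must meet it if that part is nonempty, because (b) for \<open>S = {}\<close> says that every uncolored
  vertex, also one in \<open>U\<^sup>0\<close>, has an out-neighbor. This is where \<open>l \<ge> 1\<close> enters.\<close>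

lemma coloring_digraph_proj [simp]:
  "arcs (coloring_digraph k0 l Fr P) = arcs2 k0 l Fr P \<union> arcs3 k0 l"
  "tail (coloring_digraph k0 l Fr P) = fst"
  "head (coloring_digraph k0 l Fr P) = snd"
  by (simp_all add: coloring_digraph_def with_proj_def)

lemma finite_arcs_coloring_digraph:
  assumes "\<And>j. j \<le> l \<Longrightarrow> finite (P j)"
  shows "finite (arcs (coloring_digraph k0 l Fr P))"
proof -
  have "arcs2 k0 l Fr P \<subseteq> (\<Union>j\<in>{0..l}. Vertex ` P j \<times> Copy j ` {1..k0})"
    by (fastforce simp: arcs2_def)
  moreover have "finite (\<Union>j\<in>{0..l}. Vertex ` P j \<times> Copy j ` {1..k0})"
    using assms by auto
  ultimately have "finite (arcs2 k0 l Fr P)"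
    by (rule finite_subset)
  moreover have "arcs3 k0 l \<subseteq> (\<Union>j\<in>{0..l}. Copy j ` {1..k0} \<times> Color ` {1..k0})"
    by (fastforce simp: arcs3_def)
  then have "finite (arcs3 k0 l :: 'a node rel)"
    by (rule finite_subset) auto
  ultimately show ?thesis by simp
qed

lemma card_tails_le_num_arcs:
  assumes "finite (arcs D)"
  shows "card {v \<in> R. out_heads D v \<inter> W \<noteq> {}} \<le> num_arcs D R W"
proof -
  let ?A = "{a \<in> arcs D. tail D a \<in> R \<and> head D a \<in> W}"
  have "{v \<in> R. out_heads D v \<inter> W \<noteq> {}} \<subseteq> tail D ` ?A"
    by (auto simp: out_heads_def out_arcs_def)
  then show ?thesis
    unfolding num_arcs_def using assms by (intro surj_card_le) auto
qed

text \<open>Without disjointness of the \<open>P j\<close> a vertex could have out-neighbors in several copies of the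
  color set.\<close>

lemma out_heads_vertex_subset:
  assumes "disjoint_family_on P {0..l}" "j \<le> l" "v \<in> P j"
  shows "out_heads (coloring_digraph k0 l Fr P) (Vertex v) \<subseteq> copy_nodes k0 j"
  using assms
  by (fastforce simp: out_heads_def out_arcs_def arcs2_def arcs3_def copy_nodes_def
      disjoint_family_on_def)

lemma num_arcs_copies:
  assumes "S \<subseteq> (\<Union>j\<in>{0..l}. copy_nodes k0 j)"
  shows "num_arcs (coloring_digraph k0 l Fr P) S (color_nodes k0) = card S"
proof -
  let ?A = "{a \<in> arcs2 k0 l Fr P \<union> arcs3 k0 l. fst a \<in> S \<and> snd a \<in> color_nodes k0}"
  have "inj_on fst ?A"
    by (auto simp: inj_on_def arcs2_def arcs3_def color_nodes_def)
  moreover have "fst ` ?A = S"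
  proof
    show "S \<subseteq> fst ` ?A"
    proof
      fix x assume x: "x \<in> S"
      then obtain j i where "j \<le> l" "1 \<le> i" "i \<le> k0" "x = Copy j i"
        using assms by (auto simp: copy_nodes_def)
      with x have "(x, Color i) \<in> ?A"
        by (auto simp: arcs3_def color_nodes_def)
      then show "x \<in> fst ` ?A" by force
    qed
  qed auto
  ultimately show ?thesis
    using card_image[of fst ?A] by (simp add: num_arcs_def)
qed

lemma finite_copy_nodes [simp]: "finite (copy_nodes k0 j)"
  by (simp add: copy_nodes_def)

lemma copy_nodes_disjoint: "i \<noteq> j \<Longrightarrow> copy_nodes k0 i \<inter> copy_nodes k0 j = {}"
  by (auto simp: copy_nodes_def)

theorem mainTheorem9:
  fixes V :: "'a set" and E :: "'a set set" and C P :: "nat \<Rightarrow> 'a set"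
    and k k0 l :: nat
  defines "U \<equiv> uncolored V C"
  defines "D \<equiv> coloring_digraph k0 l (free_colors V E C) P"
  defines "F \<equiv> (\<Union>j\<in>{0..l}. copy_nodes k0 j)"
  defines "FC \<equiv> (\<Union>j\<in>{1..l}. copy_nodes k0 j)"
  assumes "simple_graph V E"
    and "partial_coloring V E k C"
    and "1 \<le> k0" and "k0 \<le> card V"
    and "l \<ge> 1"
    and "clique_decomposition E U l P"
  shows "(\<forall>R S. R \<subseteq> Vertex ` U \<longrightarrow> S \<subseteq> F \<longrightarrow>
            card R \<le> num_arcs D R (F - S) + num_arcs D (S \<inter> FC) (color_nodes k0)
                      + card (P 0) * num_arcs D (S \<inter> copy_nodes k0 0) (color_nodes k0))
         \<longleftrightarrow>
         (\<forall>j\<in>{1..l}. \<forall>S. S \<subseteq> copy_nodes k0 j \<longrightarrow>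
            card {v \<in> Vertex ` U. out_heads D v \<subseteq> S} \<le> card S)"
proof -
  have disj: "disjoint_family_on P {0..l}" and U: "U = (\<Union>j\<in>{0..l}. P j)"
    using assms(10) by (auto simp: clique_decomposition_def)
  have "finite U"
    using assms(5) by (simp add: U_def uncolored_def simple_graph_def)
  have finP: "finite (P j)" if "j \<le> l" for j
    using \<open>finite U\<close> by (rule finite_subset[rotated]) (use U that in auto)
  have finA: "finite (arcs D)"
    unfolding D_def by (rule finite_arcs_coloring_digraph) (rule finP)
  have heads: "out_heads D (Vertex v) \<subseteq> copy_nodes k0 j" if "j \<le> l" "v \<in> P j" for j v
    unfolding D_def by (rule out_heads_vertex_subset[OF disj that])
  have headsF: "out_heads D v \<subseteq> F" if "v \<in> Vertex ` U" for v
    using that heads unfolding U F_def by fastforce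
  have copies: "num_arcs D S (color_nodes k0) = card S" if "S \<subseteq> F" for S
    unfolding D_def by (rule num_arcs_copies) (use that F_def in simp)
  show ?thesis (is "?a \<longleftrightarrow> ?b")
  proof
    assume a: ?a
    show ?b
    proof (intro ballI allI impI)
      fix j and S :: "'a node set" assume j: "j \<in> {1..l}" and S: "S \<subseteq> copy_nodes k0 j"
      let ?R = "{v \<in> Vertex ` U. out_heads D v \<subseteq> S}"
      have SF: "S \<subseteq> F" and SFC: "S \<inter> FC = S" using j S by (auto simp: F_def FC_def)
      have S0: "S \<inter> copy_nodes k0 0 = {}"
        using j S copy_nodes_disjoint[of j 0 k0] by auto
      have none: "num_arcs D ?R (F - S) = 0"
        by (auto simp: num_arcs_def out_heads_def out_arcs_def card_eq_0_iff)
      have empty: "num_arcs D {} (color_nodes k0) = 0"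
        by (simp add: num_arcs_def)
      have "card ?R \<le> num_arcs D ?R (F - S) + num_arcs D (S \<inter> FC) (color_nodes k0)
                      + card (P 0) * num_arcs D (S \<inter> copy_nodes k0 0) (color_nodes k0)"
        by (rule a[rule_format]) (use SF in auto)
      then show "card ?R \<le> card S"
        by (simp add: none empty S0 SFC copies[OF SF])
    qed
  next
    assume b: ?b
    have nonempty: "out_heads D v \<noteq> {}" if "v \<in> Vertex ` U" for v
    proof -
      have "card {v \<in> Vertex ` U. out_heads D v \<subseteq> {}} \<le> card ({} :: 'a node set)"
        by (rule b[rule_format, of 1]) (use \<open>l \<ge> 1\<close> in auto)
      then have "{v \<in> Vertex ` U. out_heads D v \<subseteq> {}} = {}"
        using \<open>finite U\<close> by simp
      then show ?thesis using that by blast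
    qed
    show ?a
    proof (intro allI impI)
      fix R S :: "'a node set" assume R: "R \<subseteq> Vertex ` U" and S: "S \<subseteq> F"
      have finR: "finite R" using R \<open>finite U\<close> by (auto intro: finite_subset)
      define Q where "Q j = {v \<in> R. out_heads D v \<subseteq> S} \<inter> Vertex ` P j" for j
      let ?A = "{v \<in> R. out_heads D v \<inter> (F - S) \<noteq> {}}"
      have "R \<subseteq> ?A \<union> (Q 0 \<union> (\<Union>j\<in>{1..l}. Q j))"
      proof
        fix x assume "x \<in> R"
        then obtain j where j: "j \<le> l" "x \<in> Vertex ` P j"
          using R by (auto simp: U)
        have "x \<in> ?A \<or> x \<in> Q j"
          using \<open>x \<in> R\<close> j(2) headsF[of x] R unfolding Q_def by blast
        then show "x \<in> ?A \<union> (Q 0 \<union> (\<Union>j\<in>{1..l}. Q j))"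
          using j(1) by (cases "j = 0") auto
      qed
      moreover have "finite (?A \<union> (Q 0 \<union> (\<Union>j\<in>{1..l}. Q j)))"
        using finR by (simp add: Q_def)
      ultimately have "card R \<le> card (?A \<union> (Q 0 \<union> (\<Union>j\<in>{1..l}. Q j)))"
        by (intro card_mono)
      also have "\<dots> \<le> card ?A + card (Q 0 \<union> (\<Union>j\<in>{1..l}. Q j))"
        by (rule card_Un_le)
      also have "\<dots> \<le> card ?A + (card (Q 0) + card (\<Union>j\<in>{1..l}. Q j))"
        by (intro add_left_mono card_Un_le)
      also have "\<dots> \<le> num_arcs D R (F - S)
          + (card (P 0) * card (S \<inter> copy_nodes k0 0) + card (S \<inter> FC))"
      proof (intro add_mono)
        show "card ?A \<le> num_arcs D R (F - S)"
          by (rule card_tails_le_num_arcs[OF finA])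
        show "card (Q 0) \<le> card (P 0) * card (S \<inter> copy_nodes k0 0)"
        proof (cases "Q 0 = {}")
          case False
          then obtain v where v: "v \<in> P 0" "out_heads D (Vertex v) \<subseteq> S"
            by (auto simp: Q_def)
          have "out_heads D (Vertex v) \<noteq> {}"
            using v(1) by (intro nonempty) (force simp: U)
          moreover have "out_heads D (Vertex v) \<subseteq> S \<inter> copy_nodes k0 0"
            using v heads[of 0 v] by simp
          ultimately have "S \<inter> copy_nodes k0 0 \<noteq> {}" by blast
          then have "1 \<le> card (S \<inter> copy_nodes k0 0)"
            by (simp add: Suc_le_eq card_gt_0_iff)
          have "card (Q 0) \<le> card (P 0)"
            using finP[of 0] by (intro surj_card_le[of _ _ Vertex]) (auto simp: Q_def)
          also have "\<dots> \<le> card (P 0) * card (S \<inter> copy_nodes k0 0)"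
            using \<open>1 \<le> card (S \<inter> copy_nodes k0 0)\<close> by simp
          finally show ?thesis .
        qed simp
        have "card (Q j) \<le> card (S \<inter> copy_nodes k0 j)" if j: "j \<in> {1..l}" for j
        proof -
          have "Q j \<subseteq> {v \<in> Vertex ` U. out_heads D v \<subseteq> S \<inter> copy_nodes k0 j}"
            using R heads[of j] j by (auto simp: Q_def)
          then have "card (Q j) \<le> card {v \<in> Vertex ` U. out_heads D v \<subseteq> S \<inter> copy_nodes k0 j}"
            using \<open>finite U\<close> by (intro card_mono) auto
          also have "\<dots> \<le> card (S \<inter> copy_nodes k0 j)"
            using b j by blast
          finally show ?thesis .
        qed
        then have "(\<Sum>j\<in>{1..l}. card (Q j)) \<le> (\<Sum>j\<in>{1..l}. card (S \<inter> copy_nodes k0 j))"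
          by (rule sum_mono)
        also have "\<dots> = card (\<Union>j\<in>{1..l}. S \<inter> copy_nodes k0 j)"
          using copy_nodes_disjoint[of _ _ k0]
          by (intro card_UN_disjoint[symmetric]) (simp, simp, blast)
        also have "(\<Union>j\<in>{1..l}. S \<inter> copy_nodes k0 j) = S \<inter> FC"
          by (auto simp: FC_def)
        finally show "card (\<Union>j\<in>{1..l}. Q j) \<le> card (S \<inter> FC)"
          using card_UN_le[of "{1..l}" Q] by simp
      qed
      also have "card (S \<inter> FC) = num_arcs D (S \<inter> FC) (color_nodes k0)"
        using S by (intro copies[symmetric]) auto
      also have "card (S \<inter> copy_nodes k0 0) = num_arcs D (S \<inter> copy_nodes k0 0) (color_nodes k0)"
        using S by (intro copies[symmetric]) auto
      finally show "card R \<le> num_arcs D R (F - S) + num_arcs D (S \<inter> FC) (color_nodes k0)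
          + card (P 0) * num_arcs D (S \<inter> copy_nodes k0 0) (color_nodes k0)"
        by simp
    qed
  qed
qed

end
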